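(* Let $T=\{x_1,\dots,x_n\}$ be a finite training set of independent uncertain objects with labels in $\{c,c'\}$, let $k\ge1$ be an integer such that each class contains at least $k$ objects of $T$, and let $q$ be a certain test object. Then $$\Pr\big(D(q,c)<D(q,c')\big)=\int_{R^q_{min}}^{R^q_{max}}\Pr\big(D(q,c)=R\big)\cdot\Pr\big(D(q,c')>R\big)\,\mathrm{d}R .$$
   Context: $(\mathbb{D},d)$ is a metric space (e.g. $\mathbb{R}^d$ with the Euclidean distance) equipped with a reference measure (e.g. Lebesgue measure). A certain object is an element of $\mathbb{D}$. An uncertain object $x$ is a random variable with values in $\mathbb{D}$ with probability density function $f^x$. The training objects are independent, and each carries a deterministic label. For each $x_i$ the distance $d(q,x_i)$ is a continuous real random variable, i.e. it has a density. Each uncertain object $x$ is associated with a bounded (nonempty) region $\mathrm{SUP}(x)\subseteq\mathbb{D}$ (e.g. a ball or a hypercube) with $\Pr(x\notin \mathrm{SUP}(x))=0$. For a certain object $q$, $mindist(q,x)=\inf\{d(q,w):w\in \mathrm{SUP}(x)\}$ and $maxdist(q,x)=\sup\{d(q,w):w\in \mathrm{SUP}(x)\}$. $T_c$ is the set of training objects with label $c$. $D(q,c)$ is the random variable equal to the distance between $q$ and its $k$-th nearest object among the objects of $T_c$; similarly for $c'$. Thus, with $p_i(R)=\Pr(d(q,x_i)\le R)$, $$\Pr(D(q,c)\le R)=1-\sum_{S\subseteq T_c,\ |S|<k}\ \prod_{x_i\in S}p_i(R)\prod_{x_i\in T_c\setminus S}(1-p_i(R)).$$ In the integral, $\Pr(D(q,c)=R)$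 denotes the probability density of $D(q,c)$ at $R$. $R^q_c=\min\{R\ge0: |\{x\in T_c: maxdist(q,x)\le R\}|\ge k\}$, and similarly $R^q_{c'}$. $R^q_{max}=\min\{R^q_c,R^q_{c'}\}$ and $R^q_{min}=\min_{x\in T} mindist(q,x)$. *)

theory Defs
  imports "HOL-Probability.Probability"
begin

definition has_pdf :: "'w measure \<Rightarrow> 'b measure \<Rightarrow> ('w \<Rightarrow> 'b) \<Rightarrow> ('b \<Rightarrow> real) \<Rightarrow> bool" where
  "has_pdf M N Y f \<longleftrightarrow> (\<forall>y. 0 \<le> f y) \<and> distributed M N Y (\<lambda>y. ennreal (f y))"

definition mindist :: "'a::metric_space \<Rightarrow> 'a set \<Rightarrow> real" where
  "mindist q A = (INF w\<in>A. dist q w)"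

definition maxdist :: "'a::metric_space \<Rightarrow> 'a set \<Rightarrow> real" where
  "maxdist q A = (SUP w\<in>A. dist q w)"

definition class_of :: "'i set \<Rightarrow> ('i \<Rightarrow> 'l) \<Rightarrow> 'l \<Rightarrow> 'i set" where
  "class_of T lab c = {i\<in>T. lab i = c}"

(* Distances are sorted with multiplicity, so ties do not affect the rank;
   the entry at list position k - 1 is the k-th smallest. *)
definition kth_nearest_dist :: "nat \<Rightarrow> 'a::metric_space \<Rightarrow> ('i \<Rightarrow> 'a) \<Rightarrow> 'i set \<Rightarrow> real" where
  "kth_nearest_dist k q y S =
     sorted_list_of_multiset (image_mset (\<lambda>i. dist q (y i)) (mset_set S)) ! (k - 1)"

definition R_class :: "nat \<Rightarrow> 'a::metric_space \<Rightarrow> ('i \<Rightarrow> 'a set) \<Rightarrow> 'i set \<Rightarrow> real" where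
  "R_class k q region S = (LEAST R. 0 \<le> R \<and> k \<le> card {i\<in>S. maxdist q (region i) \<le> R})"

definition R_max :: "nat \<Rightarrow> 'a::metric_space \<Rightarrow> ('i \<Rightarrow> 'a set) \<Rightarrow> 'i set \<Rightarrow> 'i set \<Rightarrow> real" where
  "R_max k q region S S' = min (R_class k q region S) (R_class k q region S')"

definition R_min :: "'a::metric_space \<Rightarrow> ('i \<Rightarrow> 'a set) \<Rightarrow> 'i set \<Rightarrow> real" where
  "R_min q region T = Min ((\<lambda>i. mindist q (region i)) ` T)"

end

theory Submission
  imports Defs
begin

text \<open>
  The event \<^term>\<open>D \<le> R\<close> says that at least \<^term>\<open>k\<close> of the distances are at most \<^term>\<open>R\<close>, and the value of
  \<^term>\<open>D\<close> is always one of these distances. The first fact gives measurability, the second absolute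
  continuity. The two order statistics are functions of disjoint subfamilies, hence independent, and
  Fubini's theorem expresses the probability as an integral over the values of the first one.
  Almost surely, the smaller of the two order statistics lies between \<^const>\<open>R_min\<close> and \<^const>\<open>R_max\<close>,
  so the integration can be restricted to this interval.
\<close>

section \<open>Order statistics of finite families\<close>

definition kth_smallest :: "nat \<Rightarrow> ('i \<Rightarrow> 'b::linorder) \<Rightarrow> 'i set \<Rightarrow> 'b" where
  "kth_smallest k y S = sorted_list_of_multiset (image_mset y (mset_set S)) ! (k - 1)"

lemma kth_nearest_dist_eq: "kth_nearest_dist k q x S = kth_smallest k (\<lambda>i. dist q (x i)) S"
  by (simp add: kth_nearest_dist_def kth_smallest_def)

text \<open>In a sorted list the entries at most \<open>r\<close> form an initial segment, and
  \<open>j\<close> lies in it exactly when it is smaller than its length.\<close>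

lemma sorted_nth_le_iff:
  fixes xs :: "'b::linorder list"
  assumes "sorted xs" "j < length xs"
  shows "xs ! j \<le> r \<longleftrightarrow> j < length (filter (\<lambda>x. x \<le> r) xs)"
  using assms
proof (induction xs arbitrary: j)
  case Nil
  then show ?case by simp
next
  case (Cons x xs)
  show ?case
  proof (cases "x \<le> r")
    case True
    with Cons show ?thesis by (cases j) auto
  next
    case False
    with Cons.prems have "\<forall>z\<in>set (x # xs). \<not> z \<le> r" by auto
    then have "filter (\<lambda>x. x \<le> r) (x # xs) = []" by (simp add: filter_empty_conv)
    moreover have "\<not> (x # xs) ! j \<le> r"
      using \<open>\<forall>z\<in>set (x # xs). \<not> z \<le> r\<close> Cons.prems(2) nth_mem by blast
    ultimately show ?thesis by simp
  qed
qed

lemma length_sorted_list_of_image_mset_set: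
  "length (sorted_list_of_multiset (image_mset y (mset_set S))) = card S"
  by (metis mset_sorted_list_of_multiset size_image_mset size_mset size_mset_set)

text \<open>Sorting keeps multiplicities, so the entries at most \<open>r\<close> are as many as the
  indices with such values. As \<open>1 \<le> k\<close>, position \<open>k - 1\<close> lies below
  this count exactly when \<open>k\<close> is at most the count.\<close>

lemma kth_smallest_le_iff:
  assumes "finite S" "1 \<le> k" "k \<le> card S"
  shows "kth_smallest k y S \<le> r \<longleftrightarrow> k \<le> card {i\<in>S. y i \<le> r}"
proof -
  let ?xs = "sorted_list_of_multiset (image_mset y (mset_set S))"
  have "length (filter (\<lambda>x. x \<le> r) ?xs) = size (filter_mset (\<lambda>x. x \<le> r) (mset ?xs))"
    by (metis mset_filter size_mset)
  also have "\<dots> = card {i\<in>S. y i \<le> r}"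
    using assms(1) by (simp add: filter_mset_image_mset)
  finally have "length (filter (\<lambda>x. x \<le> r) ?xs) = card {i\<in>S. y i \<le> r}" .
  moreover have "k - 1 < length ?xs"
    using assms by (simp add: length_sorted_list_of_image_mset_set)
  ultimately show ?thesis
    unfolding kth_smallest_def using assms(2) by (subst sorted_nth_le_iff) auto
qed

lemma kth_smallest_in_image:
  assumes "finite S" "1 \<le> k" "k \<le> card S"
  shows "kth_smallest k y S \<in> y ` S"
proof -
  let ?xs = "sorted_list_of_multiset (image_mset y (mset_set S))"
  have "?xs ! (k - 1) \<in> set ?xs"
    using assms by (intro nth_mem) (simp add: length_sorted_list_of_image_mset_set)
  also have "set ?xs = y ` S"
    using assms(1) by (metis finite_set_mset_mset_set mset_sorted_list_of_multiset set_image_mset set_mset_mset)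
  finally show ?thesis by (simp add: kth_smallest_def)
qed

lemma kth_smallest_cong:
  assumes "finite S" "\<And>i. i \<in> S \<Longrightarrow> y i = z i"
  shows "kth_smallest k y S = kth_smallest k z S"
  unfolding kth_smallest_def using assms by (intro arg_cong2[where f=nth] arg_cong[where f=sorted_list_of_multiset] image_mset_cong) auto

text \<open>By the counting criterion a sublevel set says that a finite sum of indicators reaches
  \<open>k\<close>, and this sum is measurable.\<close>

lemma borel_measurable_kth_smallest:
  fixes Y :: "'i \<Rightarrow> 'w \<Rightarrow> real"
  assumes S: "finite S" "1 \<le> k" "k \<le> card S"
    and Y: "\<And>i. i \<in> S \<Longrightarrow> Y i \<in> borel_measurable N"
  shows "(\<lambda>\<omega>. kth_smallest k (\<lambda>i. Y i \<omega>) S) \<in> borel_measurable N"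
  unfolding borel_measurable_iff_le
proof
  fix r
  have "real (card {i\<in>S. Y i \<omega> \<le> r}) = (\<Sum>i\<in>S. indicator {..r} (Y i \<omega>))" for \<omega>
    using S(1) by (simp add: indicator_def Int_def flip: sum.inter_filter)
  then have "{\<omega> \<in> space N. kth_smallest k (\<lambda>i. Y i \<omega>) S \<le> r} =
      {\<omega> \<in> space N. real k \<le> (\<Sum>i\<in>S. indicator {..r} (Y i \<omega>))}"
    by (simp add: kth_smallest_le_iff[OF S] flip: of_nat_le_iff[where 'a=real])
  also have "\<dots> \<in> sets N"
    using Y by measurable
  finally show "{\<omega> \<in> space N. kth_smallest k (\<lambda>i. Y i \<omega>) S \<le> r} \<in> sets N" .
qed

section \<open>Densities and absolute continuity\<close>

lemma has_pdf_nonneg: "has_pdf M N Y f \<Longrightarrow> 0 \<le> f y"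
  by (simp add: has_pdf_def)

lemma has_pdf_distributed: "has_pdf M N Y f \<Longrightarrow> distributed M N Y (\<lambda>y. ennreal (f y))"
  by (simp add: has_pdf_def)

lemma has_pdf_measurable: "has_pdf M N Y f \<Longrightarrow> Y \<in> measurable M N"
  by (simp add: has_pdf_def distributed_def)

text \<open>The definition gives measurability only after the embedding into \<open>ennreal\<close>;
  nonnegativity of \<open>f\<close> allows going back with \<open>enn2real\<close>.\<close>

lemma has_pdf_borel_measurable:
  assumes "has_pdf M N Y f"
  shows "f \<in> borel_measurable N"
proof -
  have "(\<lambda>y. enn2real (ennreal (f y))) \<in> borel_measurable N"
    using assms unfolding has_pdf_def distributed_def by (intro borel_measurable_enn2real) simp
  then show ?thesis
    by (simp only: enn2real_ennreal[OF has_pdf_nonneg[OF assms]])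
qed

lemma has_pdf_absolutely_continuous:
  assumes "has_pdf M N Y f"
  shows "absolutely_continuous N (distr M N Y)"
  using assms unfolding has_pdf_def distributed_def by (auto intro: absolutely_continuousI_density)

text \<open>Radon-Nikodym yields a density with values in \<open>ennreal\<close>. Its integral is 1,
  so it is finite almost everywhere, and \<open>enn2real\<close> changes it only on a null
  set.\<close>

lemma (in prob_space) absolutely_continuous_imp_has_pdf:
  assumes N: "sigma_finite_measure N" and Y: "Y \<in> measurable M N"
    and ac: "absolutely_continuous N (distr M N Y)"
  shows "\<exists>f. has_pdf M N Y f"
proof -
  interpret N: sigma_finite_measure N by fact
  obtain f where f: "f \<in> borel_measurable N" "density N f = distr M N Y"
    using N.Radon_Nikodym[OF ac] by auto
  have "integral\<^sup>N N f = emeasure (distr M N Y) (space N)"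
    by (subst f(2)[symmetric]) (simp add: emeasure_density f(1) cong: nn_integral_cong)
  also have "\<dots> = 1"
    using prob_space.emeasure_space_1[OF prob_space_distr[OF Y]] by simp
  finally have "AE x in N. f x \<noteq> \<infinity>"
    by (intro nn_integral_PInf_AE f(1)) simp
  then have "AE x in N. f x = ennreal (enn2real (f x))"
    by eventually_elim (simp add: less_top)
  then have "density N f = density N (\<lambda>x. ennreal (enn2real (f x)))"
    using f(1) by (intro density_cong) auto
  then have "has_pdf M N Y (\<lambda>x. enn2real (f x))"
    using f Y by (auto simp: has_pdf_def distributed_def)
  then show ?thesis by blast
qed

text \<open>Since the order statistic always equals some \<open>Y i\<close>, its preimage of a null
  set is covered by finitely many preimages under the \<open>Y i\<close>, each of them null.\<close>

lemma (in prob_space) has_pdf_kth_smallest: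
  fixes Y :: "'i \<Rightarrow> 'a \<Rightarrow> real"
  assumes S: "finite S" "1 \<le> k" "k \<le> card S"
    and Y: "\<And>i. i \<in> S \<Longrightarrow> \<exists>g. has_pdf M lborel (Y i) g"
  shows "\<exists>f. has_pdf M lborel (\<lambda>\<omega>. kth_smallest k (\<lambda>i. Y i \<omega>) S) f"
proof (rule absolutely_continuous_imp_has_pdf)
  let ?D = "\<lambda>\<omega>. kth_smallest k (\<lambda>i. Y i \<omega>) S"
  have meas: "Y i \<in> measurable M lborel" if "i \<in> S" for i
    using Y[OF that] has_pdf_measurable by blast
  show D: "?D \<in> measurable M lborel"
    using borel_measurable_kth_smallest[OF S, of Y M] meas by simp
  show "sigma_finite_measure (lborel :: real measure)"
    by (rule sigma_finite_lborel)
  show "absolutely_continuous lborel (distr M lborel ?D)"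
    unfolding absolutely_continuous_def
  proof
    fix A :: "real set" assume A: "A \<in> null_sets lborel"
    then have A': "A \<in> sets lborel" by auto
    have "Y i -` A \<inter> space M \<in> null_sets M" if i: "i \<in> S" for i
    proof -
      obtain g where "has_pdf M lborel (Y i) g"
        using Y[OF i] by blast
      then have "A \<in> null_sets (distr M lborel (Y i))"
        using has_pdf_absolutely_continuous A unfolding absolutely_continuous_def by blast
      then show ?thesis
        by (simp only: null_sets_distr_iff[OF meas[OF i]])
    qed
    then have "(\<Union>i\<in>S. Y i -` A \<inter> space M) \<in> null_sets M"
      using S(1) by (intro null_sets.finite_UN) auto
    moreover have "?D -` A \<inter> space M \<in> sets M"
      using D A' by (rule measurable_sets)
    moreover have "?D -` A \<inter> space M \<subseteq> (\<Union>i\<in>S. Y i -` A \<inter> space M)"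
    proof
      fix \<omega> assume "\<omega> \<in> ?D -` A \<inter> space M"
      then show "\<omega> \<in> (\<Union>i\<in>S. Y i -` A \<inter> space M)"
        using kth_smallest_in_image[OF S, of "\<lambda>i. Y i \<omega>"] by auto
    qed
    ultimately have "?D -` A \<inter> space M \<in> null_sets M"
      by (blast intro: null_sets_subset)
    then show "A \<in> null_sets (distr M lborel ?D)"
      using A' by (simp only: null_sets_distr_iff[OF D])
  qed
qed

section \<open>Independence and the integral formula\<close>

lemma (in prob_space) indep_var_kth_smallest:
  fixes Y :: "'i \<Rightarrow> 'a \<Rightarrow> real"
  assumes Y: "indep_vars (\<lambda>_. borel) Y I"
    and A: "finite A" "1 \<le> k" "k \<le> card A" "A \<subseteq> I"
    and B: "finite B" "1 \<le> l" "l \<le> card B" "B \<subseteq> I"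
    and AB: "A \<inter> B = {}"
  shows "indep_var borel (\<lambda>\<omega>. kth_smallest k (\<lambda>i. Y i \<omega>) A)
                   borel (\<lambda>\<omega>. kth_smallest l (\<lambda>i. Y i \<omega>) B)"
proof -
  have "indep_var borel ((\<lambda>y. kth_smallest k y A) \<circ> (\<lambda>\<omega>. restrict (\<lambda>i. Y i \<omega>) A))
                  borel ((\<lambda>y. kth_smallest l y B) \<circ> (\<lambda>\<omega>. restrict (\<lambda>i. Y i \<omega>) B))"
    using indep_var_restrict[OF Y AB A(4) B(4)]
    by (rule indep_var_compose)
      (auto intro!: borel_measurable_kth_smallest A B measurable_component_singleton)
  \<comment> \<open>Independence of disjoint blocks concerns restricted families; an order statistic
    over \<open>S\<close> reads only the values on \<open>S\<close>.\<close>
  moreover have "kth_smallest m (restrict (\<lambda>i. Y i \<omega>) S) S = kth_smallest m (\<lambda>i. Y i \<omega>) S"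
    if "finite S" for m \<omega> S
    using that by (rule kth_smallest_cong) simp
  ultimately show ?thesis
    using A(1) B(1) by (simp add: comp_def)
qed

text \<open>Independence makes the joint law a product, and Fubini slices the event at the value
  \<open>x\<close> of \<open>Y\<close>. The set \<open>A\<close> is carried along so that the
  integral can later be confined to an interval.\<close>

lemma (in prob_space) prob_less_eq_set_integral:
  fixes Y Z :: "'a \<Rightarrow> real"
  assumes ind: "indep_var borel Y borel Z" and f: "has_pdf M lborel Y f"
    and A: "A \<in> sets borel"
  shows "\<P>(\<omega> in M. Y \<omega> \<in> A \<and> Y \<omega> < Z \<omega>) = (LBINT x:A. f x * \<P>(\<omega> in M. Z \<omega> > x))"
proof -
  note [measurable] = A has_pdf_borel_measurable[OF f]
  have [measurable]: "Y \<in> borel_measurable M" "Z \<in> borel_measurable M"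
    using indep_var_rv1[OF ind] indep_var_rv2[OF ind] by auto
  interpret Z: prob_space "distr M borel Z"
    by (rule prob_space_distr) measurable
  \<comment> \<open>The event as a region of the plane: its slice at \<open>x\<close> is the ray
    \<open>{x<..}\<close> if \<open>x \<in> A\<close>, and empty otherwise.\<close>
  define Q where "Q = {p :: real \<times> real. fst p \<in> A \<and> fst p < snd p}"
  have Q: "Q \<in> sets (borel \<Otimes>\<^sub>M borel)"
  proof -
    have "Measurable.pred (borel \<Otimes>\<^sub>M borel) (\<lambda>p :: real \<times> real. fst p \<in> A \<and> fst p < snd p)"
      by measurable
    then show ?thesis
      by (simp add: pred_def Q_def space_pair_measure)
  qed
  have slice: "emeasure (distr M borel Z) (Pair x -` Q) =
      indicator A x * ennreal \<P>(\<omega> in M. Z \<omega> > x)" for x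
  proof -
    have "Pair x -` Q = (if x \<in> A then {x<..} else {})"
      by (auto simp: Q_def)
    then show ?thesis
      by (auto simp: emeasure_distr emeasure_eq_measure vimage_def Int_def conj_commute)
  qed
  have slice_measurable [measurable]:
    "(\<lambda>x. indicator A x * ennreal \<P>(\<omega> in M. Z \<omega> > x)) \<in> borel_measurable borel"
    using Z.measurable_emeasure_Pair[of Q borel] Q unfolding slice by (simp cong: sets_pair_measure_cong)
  have tail_measurable [measurable]: "(\<lambda>x. \<P>(\<omega> in M. Z \<omega> > x)) \<in> borel_measurable borel"
  proof -
    \<comment> \<open>The tail probability decreases in \<open>x\<close>; negating it gives a
      monotone, hence Borel, function.\<close>
    have "mono (\<lambda>x. - \<P>(\<omega> in M. Z \<omega> > x))"
      by (intro monoI) (auto intro!: finite_measure_mono)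
    then have "(\<lambda>x. - \<P>(\<omega> in M. Z \<omega> > x)) \<in> borel_measurable borel"
      by (rule borel_measurable_mono)
    then show ?thesis by simp
  qed
  have "ennreal \<P>(\<omega> in M. Y \<omega> \<in> A \<and> Y \<omega> < Z \<omega>) =
      emeasure (distr M (borel \<Otimes>\<^sub>M borel) (\<lambda>\<omega>. (Y \<omega>, Z \<omega>))) Q"
    using Q by (subst emeasure_distr)
      (auto simp: Q_def emeasure_eq_measure intro!: arg_cong[where f="measure M"])
  also have "\<dots> = emeasure (distr M borel Y \<Otimes>\<^sub>M distr M borel Z) Q"
    using ind by (simp add: indep_var_distribution_eq)
  also have "\<dots> = (\<integral>\<^sup>+x. emeasure (distr M borel Z) (Pair x -` Q) \<partial>distr M borel Y)"
    using Q by (intro Z.emeasure_pair_measure_alt) (simp cong: sets_pair_measure_cong)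
  also have "\<dots> = (\<integral>\<^sup>+\<omega>. indicator A (Y \<omega>) * ennreal \<P>(\<omega>' in M. Z \<omega>' > Y \<omega>) \<partial>M)"
    unfolding slice by (subst nn_integral_distr) auto
  also have "\<dots> = (\<integral>\<^sup>+x. ennreal (f x) * (indicator A x * ennreal \<P>(\<omega>' in M. Z \<omega>' > x)) \<partial>lborel)"
    using distributed_nn_integral[OF has_pdf_distributed[OF f],
        of "\<lambda>x. indicator A x * ennreal \<P>(\<omega>' in M. Z \<omega>' > x)"] by simp
  also have "\<dots> = (\<integral>\<^sup>+x. ennreal (indicator A x *\<^sub>R (f x * \<P>(\<omega>' in M. Z \<omega>' > x))) \<partial>lborel)"
  proof (rule nn_integral_cong)
    fix x
    show "ennreal (f x) * (indicator A x * ennreal \<P>(\<omega>' in M. Z \<omega>' > x)) =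
        ennreal (indicator A x *\<^sub>R (f x * \<P>(\<omega>' in M. Z \<omega>' > x)))"
      by (cases "x \<in> A") (simp_all add: ennreal_mult[OF has_pdf_nonneg[OF f] measure_nonneg])
  qed
  \<comment> \<open>For a nonnegative measurable integrand the Lebesgue integral is
    \<open>enn2real\<close> of the nonnegative integral, so applying \<open>enn2real\<close> to both
    sides brings the identity back to the reals.\<close>
  finally have "enn2real (ennreal \<P>(\<omega> in M. Y \<omega> \<in> A \<and> Y \<omega> < Z \<omega>)) =
      enn2real (\<integral>\<^sup>+x. ennreal (indicator A x *\<^sub>R (f x * \<P>(\<omega>' in M. Z \<omega>' > x))) \<partial>lborel)"
    by (rule arg_cong)
  then have "\<P>(\<omega> in M. Y \<omega> \<in> A \<and> Y \<omega> < Z \<omega>) =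
      enn2real (\<integral>\<^sup>+x. ennreal (indicator A x *\<^sub>R (f x * \<P>(\<omega>' in M. Z \<omega>' > x))) \<partial>lborel)"
    by (simp only: enn2real_ennreal[OF measure_nonneg])
  also have "\<dots> = (LBINT x:A. f x * \<P>(\<omega> in M. Z \<omega> > x))"
    unfolding set_lebesgue_integral_def
    by (rule integral_eq_nn_integral[symmetric]) (auto simp: has_pdf_nonneg[OF f])
  finally show ?thesis .
qed

section \<open>Deterministic bounds from the support regions\<close>

lemma mindist_le: "w \<in> A \<Longrightarrow> mindist q A \<le> dist q w"
  unfolding mindist_def by (rule cINF_lower) (auto intro: bdd_belowI[where m=0])

text \<open>A real \<open>SUP\<close> is sure to be an upper bound only when the set is bounded
  above; boundedness of \<open>A\<close> gives this for distances from any centre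
  \<open>q\<close>.\<close>

lemma le_maxdist:
  assumes "bounded A" "w \<in> A"
  shows "dist q w \<le> maxdist q A"
proof -
  obtain e where "\<forall>y\<in>A. dist q y \<le> e"
    using assms(1) bounded_any_center[of A q] by auto
  then show ?thesis
    unfolding maxdist_def by (intro cSUP_upper assms(2)) (auto intro: bdd_aboveI)
qed

lemma R_min_le:
  assumes "finite T" "i \<in> T" "w \<in> region i"
  shows "R_min q region T \<le> dist q w"
proof -
  have "R_min q region T \<le> mindist q (region i)"
    unfolding R_min_def using assms by (intro Min_le) auto
  also have "\<dots> \<le> dist q w"
    using assms(3) by (rule mindist_le)
  finally show ?thesis .
qed

text \<open>By the counting criterion the condition inside \<open>LEAST\<close> bounds the order
  statistic of the \<open>maxdist\<close> values by \<open>R\<close>, so that order statistic is the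
  least solution. It is nonnegative because each region contains a point, whose distance from
  \<open>q\<close> is at most \<open>maxdist\<close>.\<close>

lemma R_class_eq_kth_smallest:
  assumes S: "finite S" "1 \<le> k" "k \<le> card S"
    and region: "\<And>i. i \<in> S \<Longrightarrow> bounded (region i) \<and> region i \<noteq> {}"
  shows "R_class k q region S = kth_smallest k (\<lambda>i. maxdist q (region i)) S"
  unfolding R_class_def
proof (rule Least_equality)
  let ?r = "kth_smallest k (\<lambda>i. maxdist q (region i)) S"
  obtain i where i: "i \<in> S" "?r = maxdist q (region i)"
    using kth_smallest_in_image[OF S, of "\<lambda>i. maxdist q (region i)"] by auto
  obtain w where "w \<in> region i"
    using region[OF i(1)] by auto
  then have "0 \<le> ?r"
    using le_maxdist[of "region i" w q] region[OF i(1)] i(2) zero_le_dist[of q w] by linarith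
  then show "0 \<le> ?r \<and> k \<le> card {i\<in>S. maxdist q (region i) \<le> ?r}"
    by (simp flip: kth_smallest_le_iff[OF S])
next
  fix r assume "0 \<le> r \<and> k \<le> card {i\<in>S. maxdist q (region i) \<le> r}"
  then show "kth_smallest k (\<lambda>i. maxdist q (region i)) S \<le> r"
    by (simp add: kth_smallest_le_iff[OF S])
qed

text \<open>At the level \<open>kth_smallest k z S\<close> at least \<open>k\<close> of the
  \<open>z i\<close> lie below or at it, hence also the corresponding \<open>y i\<close>.\<close>

lemma kth_smallest_mono:
  assumes S: "finite S" "1 \<le> k" "k \<le> card S"
    and le: "\<And>i. i \<in> S \<Longrightarrow> y i \<le> z i"
  shows "kth_smallest k y S \<le> kth_smallest k z S"
proof -
  let ?r = "kth_smallest k z S"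
  have "k \<le> card {i\<in>S. z i \<le> ?r}"
    by (simp flip: kth_smallest_le_iff[OF S])
  also have "\<dots> \<le> card {i\<in>S. y i \<le> ?r}"
    using S(1) le by (intro card_mono) (auto intro: order_trans)
  finally show ?thesis
    by (simp add: kth_smallest_le_iff[OF S])
qed

theorem proposition3p1:
  fixes M :: "'w measure"
    and \<nu> :: "'a::metric_space measure"
    and T :: "'i set"
    and X :: "'i \<Rightarrow> 'w \<Rightarrow> 'a"
    and pdf :: "'i \<Rightarrow> 'a \<Rightarrow> real"
    and region :: "'i \<Rightarrow> 'a set"
    and lab :: "'i \<Rightarrow> 'l"
    and c c' :: 'l
    and k :: nat
    and q :: 'a
  defines "D \<equiv> (\<lambda>l \<omega>. kth_nearest_dist k q (\<lambda>i. X i \<omega>) (class_of T lab l))"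
  assumes "prob_space M"
    and "sets \<nu> = sets borel"
    and "finite T"
    and "prob_space.indep_vars M (\<lambda>_. borel) X T"
    and "\<And>i. i \<in> T \<Longrightarrow> has_pdf M \<nu> (X i) (pdf i)"
    and "\<And>i. i \<in> T \<Longrightarrow> \<exists>g. has_pdf M lborel (\<lambda>\<omega>. dist q (X i \<omega>)) g"
    and "\<And>i. i \<in> T \<Longrightarrow> bounded (region i) \<and> region i \<noteq> {}"
    and "\<And>i. i \<in> T \<Longrightarrow> AE \<omega> in M. X i \<omega> \<in> region i"
    and "c \<noteq> c'"
    and "lab ` T \<subseteq> {c, c'}"
    and "1 \<le> k"
    and "k \<le> card (class_of T lab c)"
    and "k \<le> card (class_of T lab c')"
  shows "(\<exists>f. has_pdf M lborel (D c) f) \<and>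
    (\<forall>f. has_pdf M lborel (D c) f \<longrightarrow>
      \<P>(\<omega> in M. D c \<omega> < D c' \<omega>) =
      (LBINT R = R_min q region T .. R_max k q region (class_of T lab c) (class_of T lab c').
         f R * \<P>(\<omega> in M. D c' \<omega> > R)))"
proof -
  interpret prob_space M by fact
  note T = \<open>finite T\<close> and region = assms(8)
  let ?S = "class_of T lab"
  have S: "finite (?S l)" "?S l \<subseteq> T" for l
    using T by (auto simp: class_of_def)
  have k: "1 \<le> k" "k \<le> card (?S c)" "k \<le> card (?S c')"
    by fact+
  note Sc = S(1)[of c] k(1,2) and Sc' = S(1)[of c'] k(1,3)
  define Y where "Y = (\<lambda>i \<omega>. dist q (X i \<omega>))"
  have D: "D l = (\<lambda>\<omega>. kth_smallest k (\<lambda>i. Y i \<omega>) (?S l))" for l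
    by (simp add: D_def Y_def kth_nearest_dist_eq)
  \<comment> \<open>The distance from \<open>q\<close> is continuous, so independence of the objects
    passes to their distances.\<close>
  have indep: "indep_vars (\<lambda>_. borel) Y T"
    unfolding Y_def using assms(5)
    by (rule indep_vars_compose2) (intro borel_measurable_continuous_onI continuous_intros)
  have ind: "indep_var borel (D c) borel (D c')"
    unfolding D using S \<open>c \<noteq> c'\<close> k
    by (intro indep_var_kth_smallest[OF indep]) (auto simp: class_of_def)
  have pdf: "\<exists>f. has_pdf M lborel (D c) f"
    unfolding D using assms(7) S(2) by (intro has_pdf_kth_smallest Sc) (auto simp: Y_def)
  have [measurable]: "D c \<in> borel_measurable M" "D c' \<in> borel_measurable M"
    using indep_var_rv1[OF ind] indep_var_rv2[OF ind] by auto

  let ?a = "R_min q region T" and ?b = "R_max k q region (?S c) (?S c')"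
  have R_class: "R_class k q region (?S l) = kth_smallest k (\<lambda>i. maxdist q (region i)) (?S l)"
    if "k \<le> card (?S l)" for l
    using region S(2) that k(1) by (intro R_class_eq_kth_smallest S(1)) auto
  \<comment> \<open>The endpoints must be in order, since the interval integral is oriented. A point
    of the region that attains the order statistic of \<open>maxdist\<close> separates them.\<close>
  have "?a \<le> R_class k q region (?S l)" if l: "k \<le> card (?S l)" for l
  proof -
    obtain i where i: "i \<in> ?S l" "R_class k q region (?S l) = maxdist q (region i)"
      using kth_smallest_in_image[OF S(1) k(1) l, of "\<lambda>i. maxdist q (region i)"] R_class[OF l] by auto
    have iT: "i \<in> T"
      using i(1) S(2) by auto
    obtain w where w: "w \<in> region i"
      using region[OF iT] by auto
    then have "?a \<le> dist q w"
      by (rule R_min_le[where region=region, OF T iT])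
    also have "\<dots> \<le> R_class k q region (?S l)"
      unfolding i(2) using region[OF iT] w by (intro le_maxdist) auto
    finally show ?thesis .
  qed
  then have ab: "?a \<le> ?b"
    using k by (simp add: R_max_def)
  have "AE \<omega> in M. \<forall>i\<in>T. X i \<omega> \<in> region i"
    using assms(9) by (intro AE_finite_allI T) auto
  \<comment> \<open>On the event, \<open>D c\<close> is below \<open>D c'\<close> and so inherits
    its upper bound, which puts it below the minimum of both class bounds. Outside the event it
    could exceed the bound of \<open>c'\<close>.\<close>
  then have bounds: "AE \<omega> in M. D c \<omega> < D c' \<omega> \<longrightarrow> D c \<omega> \<in> {?a..?b}"
  proof eventually_elim
    case (elim \<omega>)
    have "D l \<omega> \<le> R_class k q region (?S l)" if l: "k \<le> card (?S l)" for l
      unfolding D R_class[OF l]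
      using elim region S(2) by (intro kth_smallest_mono S k l) (auto simp: Y_def intro!: le_maxdist)
    moreover have "?a \<le> D c \<omega>"
    proof -
      obtain i where i: "i \<in> ?S c" "D c \<omega> = Y i \<omega>"
        using kth_smallest_in_image[OF Sc, of "\<lambda>i. Y i \<omega>"] by (auto simp: D)
      then show ?thesis
        using elim S(2) by (auto simp: Y_def intro!: R_min_le[OF T])
    qed
    ultimately show ?case
      using k by (fastforce simp: R_max_def)
  qed
  have "\<P>(\<omega> in M. D c \<omega> < D c' \<omega>) =
      (LBINT R = ?a .. ?b. f R * \<P>(\<omega> in M. D c' \<omega> > R))"
    if f: "has_pdf M lborel (D c) f" for f
  proof -
    \<comment> \<open>The interval condition can be added at no cost in probability, as it holds
      almost surely on the event.\<close>
    have "\<P>(\<omega> in M. D c \<omega> < D c' \<omega>) = \<P>(\<omega> in M. D c \<omega> \<in> {?a..?b} \<and> D c \<omega> < D c' \<omega>)"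
      using bounds by (intro finite_measure_eq_AE) auto
    also have "\<dots> = (LBINT R:{?a..?b}. f R * \<P>(\<omega> in M. D c' \<omega> > R))"
      by (rule prob_less_eq_set_integral[OF ind f]) simp
    also have "\<dots> = (LBINT R = ?a .. ?b. f R * \<P>(\<omega> in M. D c' \<omega> > R))"
      by (rule interval_integral_Icc[OF ab, symmetric])
    finally show ?thesis .
  qed
  with pdf show ?thesis by blast
qed

end
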